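(* $\mathbf{CFL_e}$, $\mathbf{CFL_{ew}}$ and $\mathbf{CPC}$ each have a sequent calculus consisting only of focused rules and focused axioms.
   Context: $\mathbf{CFL_e}$: multi-conclusion commutative full Lambek calculus (axioms $\phi\Rightarrow\phi$, $\Rightarrow1$, $0\Rightarrow$, $\Gamma\Rightarrow\top,\Delta$, $\Gamma,\bot\Rightarrow\Delta$ and standard multi-conclusion rules for $1,0,\wedge,\vee,*,\to,+$); $\mathbf{CFL_{ew}}$ adds left and right weakening; $\mathbf{CPC}$ classical logic. A sequent calculus for a logic $L$ proves exactly the sequents $\Gamma\Rightarrow\Delta$ with $L\vdash\ast\Gamma\to+\Delta$; negation $\neg\phi$ is $\phi\to0$ (or classical negation). Rules are schemes over meta-formulas (formulas with formula variables; $V$ = variables/atoms occurring) and meta-multiset variables. Focused rules: left: premises $\Gamma_i,\bar\phi_{ir}\Rightarrow\Delta_i$, conclusion $\Gamma_1,\dots,\Gamma_n,\phi\Rightarrow\Delta_1,\dots,\Delta_n$; right: premises $\Gamma_i\Rightarrow\bar\phi_{ir},\Delta_i$, conclusion $\Gamma_1,\dots,\Gamma_n\Rightarrow\Delta_1,\dots,\Delta_n,\phi$; $\Gamma_i,\Delta_i$ meta-multiset variables and all variables of $\bar\phi_{ir}$ in $V(\phi)$. Focused axioms: $\phi\Rightarrow\phi$; $\Rightarrow\bar\alpha$; $\bar\beta\Rightarrow$; $\Gamma,\bar\phi\Rightarrow\Delta$; $\Gamma\Rightarrow\bar\phi,\Delta$, where any two elements of $\bar\alpha$ (resp. $\bar\beta,\bar\phi$)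 have the same variables and $\Gamma,\Delta$ are meta-multiset variables. *)

theory Defs
  imports Main "HOL-Library.Multiset"
begin

datatype 'v fm =
    Atom 'v
  | One | Zero | Top | Bot
  | And "'v fm" "'v fm"
  | Or "'v fm" "'v fm"
  | Fus "'v fm" "'v fm"   (* multiplicative conjunction "*" *)
  | Imp "'v fm" "'v fm"
  | Par "'v fm" "'v fm"   (* multiplicative disjunction "+" *)

type_synonym 'a sequent = "'a fm multiset \<times> 'a fm multiset"

fun big_fus :: "'a fm list \<Rightarrow> 'a fm" where
  "big_fus [] = One"
| "big_fus [x] = x"
| "big_fus (x # y # zs) = Fus x (big_fus (y # zs))"

fun big_par :: "'a fm list \<Rightarrow> 'a fm" where
  "big_par [] = Zero"
| "big_par [x] = x"
| "big_par (x # y # zs) = Par x (big_par (y # zs))"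


text \<open>
  The multi-conclusion calculus for CFL\<open>\<^sub>e\<close>; the flag \<open>w\<close> switches on left and right weakening
  (giving CFL\<open>\<^sub>e\<^sub>w\<close>). Exchange is built into multisets. The cut rule is included, so that the
  logics below are closed under modus ponens by definition.
\<close>

inductive CFL :: "bool \<Rightarrow> 'a fm multiset \<Rightarrow> 'a fm multiset \<Rightarrow> bool" for w :: bool where
  identity: "CFL w {#A#} {#A#}"
| cut: "CFL w \<Gamma> (add_mset A \<Delta>) \<Longrightarrow> CFL w (add_mset A \<Sigma>) \<Lambda> \<Longrightarrow> CFL w (\<Gamma> + \<Sigma>) (\<Delta> + \<Lambda>)"
| oneR: "CFL w {#} {#One#}"
| oneL: "CFL w \<Gamma> \<Delta> \<Longrightarrow> CFL w (add_mset One \<Gamma>) \<Delta>"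
| zeroL: "CFL w {#Zero#} {#}"
| zeroR: "CFL w \<Gamma> \<Delta> \<Longrightarrow> CFL w \<Gamma> (add_mset Zero \<Delta>)"
| topR: "CFL w \<Gamma> (add_mset Top \<Delta>)"
| botL: "CFL w (add_mset Bot \<Gamma>) \<Delta>"
| andL1: "CFL w (add_mset A \<Gamma>) \<Delta> \<Longrightarrow> CFL w (add_mset (And A B) \<Gamma>) \<Delta>"
| andL2: "CFL w (add_mset B \<Gamma>) \<Delta> \<Longrightarrow> CFL w (add_mset (And A B) \<Gamma>) \<Delta>"
| andR: "CFL w \<Gamma> (add_mset A \<Delta>) \<Longrightarrow> CFL w \<Gamma> (add_mset B \<Delta>) \<Longrightarrow>
    CFL w \<Gamma> (add_mset (And A B) \<Delta>)"
| orL: "CFL w (add_mset A \<Gamma>) \<Delta> \<Longrightarrow> CFL w (add_mset B \<Gamma>) \<Delta> \<Longrightarrow>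
    CFL w (add_mset (Or A B) \<Gamma>) \<Delta>"
| orR1: "CFL w \<Gamma> (add_mset A \<Delta>) \<Longrightarrow> CFL w \<Gamma> (add_mset (Or A B) \<Delta>)"
| orR2: "CFL w \<Gamma> (add_mset B \<Delta>) \<Longrightarrow> CFL w \<Gamma> (add_mset (Or A B) \<Delta>)"
| fusL: "CFL w (add_mset A (add_mset B \<Gamma>)) \<Delta> \<Longrightarrow> CFL w (add_mset (Fus A B) \<Gamma>) \<Delta>"
| fusR: "CFL w \<Gamma> (add_mset A \<Delta>) \<Longrightarrow> CFL w \<Sigma> (add_mset B \<Lambda>) \<Longrightarrow>
    CFL w (\<Gamma> + \<Sigma>) (add_mset (Fus A B) (\<Delta> + \<Lambda>))"
| impL: "CFL w \<Gamma> (add_mset A \<Delta>) \<Longrightarrow> CFL w (add_mset B \<Sigma>) \<Lambda> \<Longrightarrow>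
    CFL w (add_mset (Imp A B) (\<Gamma> + \<Sigma>)) (\<Delta> + \<Lambda>)"
| impR: "CFL w (add_mset A \<Gamma>) (add_mset B \<Delta>) \<Longrightarrow> CFL w \<Gamma> (add_mset (Imp A B) \<Delta>)"
| parL: "CFL w (add_mset A \<Gamma>) \<Delta> \<Longrightarrow> CFL w (add_mset B \<Sigma>) \<Lambda> \<Longrightarrow>
    CFL w (add_mset (Par A B) (\<Gamma> + \<Sigma>)) (\<Delta> + \<Lambda>)"
| parR: "CFL w \<Gamma> (add_mset A (add_mset B \<Delta>)) \<Longrightarrow> CFL w \<Gamma> (add_mset (Par A B) \<Delta>)"
| weakL: "w \<Longrightarrow> CFL w \<Gamma> \<Delta> \<Longrightarrow> CFL w (add_mset A \<Gamma>) \<Delta>"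
| weakR: "w \<Longrightarrow> CFL w \<Gamma> \<Delta> \<Longrightarrow> CFL w \<Gamma> (add_mset A \<Delta>)"

definition CFL_e :: "'a fm set" where
  "CFL_e = {A. CFL False {#} {#A#}}"

definition CFL_ew :: "'a fm set" where
  "CFL_ew = {A. CFL True {#} {#A#}}"

text \<open>
  Classical logic over the same language: \<open>1\<close> and \<open>\<top>\<close>, \<open>0\<close> and \<open>\<bottom>\<close>, \<open>*\<close> and \<open>\<and>\<close>, \<open>+\<close> and \<open>\<or>\<close>
  are identified, and \<open>A \<rightarrow> 0\<close> is classical negation.
\<close>

primrec truth :: "('a \<Rightarrow> bool) \<Rightarrow> 'a fm \<Rightarrow> bool" where
  "truth v (Atom p) = v p"
| "truth v One = True"
| "truth v Zero = False"
| "truth v Top = True"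
| "truth v Bot = False"
| "truth v (And A B) = (truth v A \<and> truth v B)"
| "truth v (Or A B) = (truth v A \<or> truth v B)"
| "truth v (Fus A B) = (truth v A \<and> truth v B)"
| "truth v (Imp A B) = (truth v A \<longrightarrow> truth v B)"
| "truth v (Par A B) = (truth v A \<or> truth v B)"

definition CPC :: "'a fm set" where
  "CPC = {A. \<forall>v. truth v A}"


text \<open>
  The atomic parts of a meta-formula are atoms of the object language (left alone by
  instantiation) and formula variables; \<open>set_fm \<phi>\<close> is then the set \<open>V(\<phi>)\<close>.
\<close>

datatype 'a msymb = Obj 'a | FVar nat

type_synonym 'a mform = "'a msymb fm"

datatype 'a mitem = MVar nat | MForm "'a mform"

type_synonym 'a mseq = "'a mitem multiset \<times> 'a mitem multiset"

text \<open>A rule is its list of premises with its conclusion; an axiom is a rule without premises.\<close>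

type_synonym 'a rule = "'a mseq list \<times> 'a mseq"

primrec inst_symb :: "(nat \<Rightarrow> 'a fm) \<Rightarrow> 'a msymb \<Rightarrow> 'a fm" where
  "inst_symb \<sigma> (Obj a) = Atom a"
| "inst_symb \<sigma> (FVar x) = \<sigma> x"

primrec inst :: "(nat \<Rightarrow> 'a fm) \<Rightarrow> 'a mform \<Rightarrow> 'a fm" where
  "inst \<sigma> (Atom s) = inst_symb \<sigma> s"
| "inst \<sigma> One = One"
| "inst \<sigma> Zero = Zero"
| "inst \<sigma> Top = Top"
| "inst \<sigma> Bot = Bot"
| "inst \<sigma> (And A B) = And (inst \<sigma> A) (inst \<sigma> B)"
| "inst \<sigma> (Or A B) = Or (inst \<sigma> A) (inst \<sigma> B)"
| "inst \<sigma> (Fus A B) = Fus (inst \<sigma> A) (inst \<sigma> B)"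
| "inst \<sigma> (Imp A B) = Imp (inst \<sigma> A) (inst \<sigma> B)"
| "inst \<sigma> (Par A B) = Par (inst \<sigma> A) (inst \<sigma> B)"

primrec inst_item :: "(nat \<Rightarrow> 'a fm) \<Rightarrow> (nat \<Rightarrow> 'a fm multiset) \<Rightarrow> 'a mitem \<Rightarrow> 'a fm multiset" where
  "inst_item \<sigma> \<tau> (MVar X) = \<tau> X"
| "inst_item \<sigma> \<tau> (MForm \<phi>) = {#inst \<sigma> \<phi>#}"

definition inst_mset ::
  "(nat \<Rightarrow> 'a fm) \<Rightarrow> (nat \<Rightarrow> 'a fm multiset) \<Rightarrow> 'a mitem multiset \<Rightarrow> 'a fm multiset" where
  "inst_mset \<sigma> \<tau> M = (\<Sum>x\<in>#M. inst_item \<sigma> \<tau> x)"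

definition inst_seq ::
  "(nat \<Rightarrow> 'a fm) \<Rightarrow> (nat \<Rightarrow> 'a fm multiset) \<Rightarrow> 'a mseq \<Rightarrow> 'a sequent" where
  "inst_seq \<sigma> \<tau> S = (inst_mset \<sigma> \<tau> (fst S), inst_mset \<sigma> \<tau> (snd S))"

inductive derivable :: "'a rule set \<Rightarrow> 'a sequent \<Rightarrow> bool" for G :: "'a rule set" where
  "(Ps, C) \<in> G \<Longrightarrow> (\<forall>P \<in> set Ps. derivable G (inst_seq \<sigma> \<tau> P)) \<Longrightarrow>
    derivable G (inst_seq \<sigma> \<tau> C)"

definition calculus_for :: "'a rule set \<Rightarrow> 'a fm set \<Rightarrow> bool" where
  "calculus_for G L \<longleftrightarrow>
    (\<forall>\<Gamma> \<Delta>. derivable G (mset \<Gamma>, mset \<Delta>) \<longleftrightarrow> Imp (big_fus \<Gamma>) (big_par \<Delta>) \<in> L)"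


text \<open>
  The \<open>i\<close>-th entry \<open>(g, d, \<Phi>s)\<close> of the list \<open>bs\<close> stands for the block of premises with index \<open>i\<close>:
  \<open>g\<close> and \<open>d\<close> are the meta-multiset variables \<open>\<Gamma>\<^sub>i\<close> and \<open>\<Delta>\<^sub>i\<close>, shared by all premises of the
  block, and \<open>\<Phi>s\<close> lists the multisets of active meta-formulas, one for each \<open>r\<close>.
\<close>

type_synonym 'a block = "nat \<times> nat \<times> 'a mform multiset list"

definition ctxL :: "'a block list \<Rightarrow> 'a mitem multiset" where
  "ctxL bs = mset (map (\<lambda>(g, d, \<Phi>s). MVar g) bs)"

definition ctxR :: "'a block list \<Rightarrow> 'a mitem multiset" where
  "ctxR bs = mset (map (\<lambda>(g, d, \<Phi>s). MVar d) bs)"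

definition ok_blocks :: "'a block list \<Rightarrow> 'a mform \<Rightarrow> bool" where
  "ok_blocks bs \<phi> \<longleftrightarrow>
     bs \<noteq> [] \<and>
     distinct (map (\<lambda>(g, d, \<Phi>s). g) bs @ map (\<lambda>(g, d, \<Phi>s). d) bs) \<and>
     (\<forall>(g, d, \<Phi>s) \<in> set bs. \<Phi>s \<noteq> [] \<and>
        (\<forall>\<Phi> \<in> set \<Phi>s. \<forall>\<psi> \<in># \<Phi>. set_fm \<psi> \<subseteq> set_fm \<phi>))"

inductive focused_rule :: "'a rule \<Rightarrow> bool" where
  left: "ok_blocks bs \<phi> \<Longrightarrow>
    focused_rule
     (concat (map (\<lambda>(g, d, \<Phi>s).
        map (\<lambda>\<Phi>. (add_mset (MVar g) (image_mset MForm \<Phi>), {#MVar d#})) \<Phi>s) bs),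
      (add_mset (MForm \<phi>) (ctxL bs), ctxR bs))"
| right: "ok_blocks bs \<phi> \<Longrightarrow>
    focused_rule
     (concat (map (\<lambda>(g, d, \<Phi>s).
        map (\<lambda>\<Phi>. ({#MVar g#}, add_mset (MVar d) (image_mset MForm \<Phi>))) \<Phi>s) bs),
      (ctxL bs, add_mset (MForm \<phi>) (ctxR bs)))"

definition same_vars :: "'a mform multiset \<Rightarrow> bool" where
  "same_vars \<Phi> \<longleftrightarrow> (\<forall>\<phi> \<in># \<Phi>. \<forall>\<psi> \<in># \<Phi>. set_fm \<phi> = set_fm \<psi>)"

inductive focused_axiom :: "'a rule \<Rightarrow> bool" where
  "focused_axiom ([], ({#MForm \<phi>#}, {#MForm \<phi>#}))"
| "same_vars \<Phi> \<Longrightarrow> focused_axiom ([], ({#}, image_mset MForm \<Phi>))"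
| "same_vars \<Phi> \<Longrightarrow> focused_axiom ([], (image_mset MForm \<Phi>, {#}))"
| "same_vars \<Phi> \<Longrightarrow> g \<noteq> d \<Longrightarrow>
    focused_axiom ([], (add_mset (MVar g) (image_mset MForm \<Phi>), {#MVar d#}))"
| "same_vars \<Phi> \<Longrightarrow> g \<noteq> d \<Longrightarrow>
    focused_axiom ([], ({#MVar g#}, add_mset (MVar d) (image_mset MForm \<Phi>)))"

end

theory Submission
  imports Defs "HOL-Library.Set_Algebras" "HOL-Library.Product_Plus"
begin

text \<open>
  The obstacle to focusing the usual calculus are the implication rules, which move a formula to
  the other side of the sequent. We keep every formula on its side by giving rules for each
  connective and for its negation (writing \<open>\<not>A\<close> for \<open>A \<rightarrow> 0\<close>), on both sides; then \<open>A \<rightarrow> B\<close> is treated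
  like \<open>\<not>A + B\<close>, and weakening and contraction are focused anyway.
  Cut is not focused, so its admissibility has to be shown. Following Okada, this is done with the
  phase semantics over the monoid of sequents whose pole \<open>D\<close> consists of the derivable ones: every
  formula \<open>A\<close> satisfies \<open>(A \<Rightarrow>), (\<Rightarrow> \<not>A) \<in> \<lbrakk>A\<rbrakk>\<close> and \<open>(\<Rightarrow> A), (\<not>A \<Rightarrow>) \<in> \<lbrakk>A\<rbrakk>\<^sup>\<bottom>\<close>, whence soundness of the
  semantics for the calculus with cut turns into derivability without cut.
  For classical logic, closure of \<open>D\<close> under weakening and contraction makes an element that decides
  the atoms according to a valuation decide all formulas (as in Kalmar's completeness proof), and
  the atoms can be eliminated one at a time.
\<close>

section \<open>Phase spaces\<close>

locale phase_space =
  fixes D :: "'m::comm_monoid_add set"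
begin

definition perp :: "'m set \<Rightarrow> 'm set" where
  "perp X = {m. \<forall>x\<in>X. m + x \<in> D}"

lemma perpI: "(\<And>x. x \<in> X \<Longrightarrow> m + x \<in> D) \<Longrightarrow> m \<in> perp X"
  by (simp add: perp_def)

lemma perpD: "m \<in> perp X \<Longrightarrow> x \<in> X \<Longrightarrow> m + x \<in> D"
  by (simp add: perp_def)

text \<open>Adjointness of addition and \<open>perp\<close>: one summand of an inclusion in the pole
  can be carried to the other side. This is how \<open>holds_left_iff\<close> and
  \<open>holds_right_iff\<close> isolate a principal formula.\<close>

lemma plus_subset_iff: "X + Y \<subseteq> D \<longleftrightarrow> X \<subseteq> perp Y"
  by (auto simp: set_plus_def perp_def)

lemma perp_antimono: "X \<subseteq> Y \<Longrightarrow> perp Y \<subseteq> perp X"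
  by (auto simp: perp_def)

lemma subset_perp_perp: "X \<subseteq> perp (perp X)"
  by (auto simp: perp_def add.commute)

lemma perp_perp_perp [simp]: "perp (perp (perp X)) = perp X"
  using subset_perp_perp perp_antimono by (metis subset_antisym)

lemma perp_Un: "perp (X \<union> Y) = perp X \<inter> perp Y"
  by (auto simp: perp_def)

text \<open>A meet of closed sets is closed, because \<open>perp_Un\<close> exhibits it as the
  \<open>perp\<close> of a union.\<close>

lemma perp_perp_Int: "perp (perp (perp X \<inter> perp Y)) = perp X \<inter> perp Y"
  by (metis perp_Un perp_perp_perp)

lemma perp_zero [simp]: "perp {0} = D"
  by (auto simp: perp_def)

lemma perp_perp_D [simp]: "perp (perp D) = D"
  by (metis perp_zero perp_perp_perp)

lemma perp_empty: "perp {} = UNIV"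
  by (auto simp: perp_def)

lemma perp_perp_UNIV [simp]: "perp (perp UNIV) = UNIV"
  by (metis perp_empty perp_perp_perp)

text \<open>Double \<open>perp\<close> at atoms makes every value closed, whatever \<open>I\<close>
  is. Since \<open>itp I B\<close> is closed, the clause for \<open>Imp\<close> is the residual: all
  m whose sums with elements of \<open>itp I A\<close> lie in \<open>itp I B\<close>. In particular
  \<open>Imp A Zero\<close> has the value \<open>perp (itp I A)\<close>.\<close>

primrec itp :: "('a \<Rightarrow> 'm set) \<Rightarrow> 'a fm \<Rightarrow> 'm set" where
  "itp I (Atom p) = perp (perp (I p))"
| "itp I One = perp D"
| "itp I Zero = D"
| "itp I Top = UNIV"
| "itp I Bot = perp UNIV"
| "itp I (And A B) = itp I A \<inter> itp I B"
| "itp I (Or A B) = perp (perp (itp I A) \<inter> perp (itp I B))"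
| "itp I (Fus A B) = perp (perp (itp I A + itp I B))"
| "itp I (Imp A B) = perp (itp I A + perp (itp I B))"
| "itp I (Par A B) = perp (perp (itp I A) + perp (itp I B))"

lemma itp_closed [simp]: "perp (perp (itp I A)) = itp I A"
proof (induction A)
  case (And A B)
  then show ?case using perp_perp_Int[of "perp (itp I A)" "perp (itp I B)"] by simp
qed simp_all

section \<open>Soundness of the phase semantics for the calculus with cut\<close>

definition holds :: "('a \<Rightarrow> 'm set) \<Rightarrow> 'a fm multiset \<Rightarrow> 'a fm multiset \<Rightarrow> bool" where
  "holds I \<Gamma> \<Delta> \<longleftrightarrow> (\<Sum>A\<in>#\<Gamma>. itp I A) + (\<Sum>B\<in>#\<Delta>. perp (itp I B)) \<subseteq> D"

lemma holds_left_iff: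
  "holds I (add_mset A \<Gamma>) \<Delta> \<longleftrightarrow>
     (\<Sum>A\<in>#\<Gamma>. itp I A) + (\<Sum>B\<in>#\<Delta>. perp (itp I B)) \<subseteq> perp (itp I A)"
  by (simp add: holds_def plus_subset_iff[symmetric] ac_simps)

lemma holds_right_iff:
  "holds I \<Gamma> (add_mset A \<Delta>) \<longleftrightarrow>
     (\<Sum>A\<in>#\<Gamma>. itp I A) + (\<Sum>B\<in>#\<Delta>. perp (itp I B)) \<subseteq> itp I A"
proof -
  have "holds I \<Gamma> (add_mset A \<Delta>) \<longleftrightarrow>
     ((\<Sum>A\<in>#\<Gamma>. itp I A) + (\<Sum>B\<in>#\<Delta>. perp (itp I B))) + perp (itp I A) \<subseteq> D"
    by (simp add: holds_def ac_simps)
  then show ?thesis by (simp add: plus_subset_iff)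
qed

lemma plus_subset_plus:
  fixes X :: "'m set"
  assumes "X + Y \<subseteq> U" "X' + Y' \<subseteq> V"
  shows "(X + X') + (Y + Y') \<subseteq> U + V"
  using set_plus_mono2[OF assms] by (simp add: ac_simps)

text \<open>Read through \<open>holds_left_iff\<close> and \<open>holds_right_iff\<close>, each
  logical rule says that the sum of the context lies in a set attached to the principal formula.
  Only weakening asks the pole to absorb arbitrary summands, so \<open>weak\<close> is guarded by
  \<open>w\<close>.\<close>

lemma CFL_holds:
  assumes "CFL w \<Gamma> \<Delta>" and weak: "\<And>m k. w \<Longrightarrow> m \<in> D \<Longrightarrow> m + k \<in> D"
  shows "holds I \<Gamma> \<Delta>"
  using assms(1)
proof (induction rule: CFL.induct)
  case (identity A)
  then show ?case by (simp add: holds_left_iff)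
next
  case (cut \<Gamma> A \<Delta> \<Sigma> \<Lambda>)
  \<comment> \<open>The context sums of the two premises lie in \<open>itp I A\<close> and in its
    \<open>perp\<close>, so together they end up in the pole.\<close>
  have "itp I A + perp (itp I A) \<subseteq> D"
    using subset_perp_perp plus_subset_iff by blast
  then show ?case
    using plus_subset_plus[OF cut.IH[unfolded holds_left_iff holds_right_iff]]
    by (simp add: holds_def)
next
  case oneR
  then show ?case by (simp add: holds_def plus_subset_iff)
next
  case (oneL \<Gamma> \<Delta>)
  then show ?case by (simp add: holds_left_iff) (simp add: holds_def)
next
  case zeroL
  then show ?case by (simp add: holds_def)
next
  case (zeroR \<Gamma> \<Delta>)
  then show ?case by (simp add: holds_right_iff) (simp add: holds_def)
next
  case (topR \<Gamma> \<Delta>)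
  then show ?case by (simp add: holds_right_iff)
next
  case (botL \<Gamma> \<Delta>)
  then show ?case by (simp add: holds_left_iff)
next
  case (andL1 A \<Gamma> \<Delta> B)
  then show ?case using perp_antimono[of "itp I A \<inter> itp I B" "itp I A"]
    by (auto simp: holds_left_iff)
next
  case (andL2 B \<Gamma> \<Delta> A)
  then show ?case using perp_antimono[of "itp I A \<inter> itp I B" "itp I B"]
    by (auto simp: holds_left_iff)
next
  case (andR \<Gamma> A \<Delta> B)
  then show ?case by (simp add: holds_right_iff)
next
  case (orL A \<Gamma> \<Delta> B)
  then show ?case by (simp add: holds_left_iff perp_perp_Int)
next
  case (orR1 \<Gamma> A \<Delta> B)
  then show ?case using perp_antimono[of "perp (itp I A) \<inter> perp (itp I B)" "perp (itp I A)"]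
    by (auto simp: holds_right_iff)
next
  case (orR2 \<Gamma> B \<Delta> A)
  then show ?case using perp_antimono[of "perp (itp I A) \<inter> perp (itp I B)" "perp (itp I B)"]
    by (auto simp: holds_right_iff)
next
  case (fusL A B \<Gamma> \<Delta>)
  then have "(\<Sum>A\<in>#\<Gamma>. itp I A) + (\<Sum>B\<in>#\<Delta>. perp (itp I B)) \<subseteq> perp (itp I A + itp I B)"
    by (simp add: plus_subset_iff[symmetric] holds_def ac_simps)
  then show ?case by (simp add: holds_left_iff)
next
  case (fusR \<Gamma> A \<Delta> \<Sigma> B \<Lambda>)
  then show ?case using plus_subset_plus[OF fusR.IH[unfolded holds_right_iff]]
      subset_perp_perp[of "itp I A + itp I B"]
    by (simp add: holds_right_iff)
next
  case (impL \<Gamma> A \<Delta> B \<Sigma> \<Lambda>)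
  then show ?case using plus_subset_plus[OF impL.IH[unfolded holds_left_iff holds_right_iff]]
      subset_perp_perp[of "itp I A + perp (itp I B)"]
    by (simp add: holds_left_iff)
next
  case (impR A \<Gamma> B \<Delta>)
  then have "(\<Sum>A\<in>#\<Gamma>. itp I A) + (\<Sum>B\<in>#\<Delta>. perp (itp I B)) \<subseteq> perp (itp I A + perp (itp I B))"
    by (simp add: plus_subset_iff[symmetric] holds_def ac_simps)
  then show ?case by (simp add: holds_right_iff)
next
  case (parL A \<Gamma> \<Delta> B \<Sigma> \<Lambda>)
  then show ?case using plus_subset_plus[OF parL.IH[unfolded holds_left_iff]]
      subset_perp_perp[of "perp (itp I A) + perp (itp I B)"]
    by (simp add: holds_left_iff)
next
  case (parR \<Gamma> A B \<Delta>)
  then have "(\<Sum>A\<in>#\<Gamma>. itp I A) + (\<Sum>B\<in>#\<Delta>. perp (itp I B)) \<subseteq> perp (perp (itp I A) + perp (itp I B))"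
    by (simp add: plus_subset_iff[symmetric] holds_def ac_simps)
  then show ?case by (simp add: holds_right_iff)
next
  case (weakL \<Gamma> \<Delta> A)
  then have "D \<subseteq> perp (itp I A)" using weak by (auto simp: perp_def)
  with weakL show ?case unfolding holds_left_iff by (simp add: holds_def)
next
  case (weakR \<Gamma> \<Delta> A)
  then have "D \<subseteq> perp (perp (itp I A))"
    using weak unfolding perp_def by blast
  with weakR show ?case unfolding holds_right_iff by (simp add: holds_def)
qed

section \<open>Deciding formulas when the pole admits weakening and contraction\<close>

definition decides :: "('a \<Rightarrow> 'm set) \<Rightarrow> ('a \<Rightarrow> bool) \<Rightarrow> 'm \<Rightarrow> 'a fm \<Rightarrow> bool" where
  "decides I v m A \<longleftrightarrow> (if truth v A then m \<in> itp I A else m \<in> perp (itp I A))"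

lemma decides_if_decides_atoms:
  assumes weak: "\<And>m k. m \<in> D \<Longrightarrow> m + k \<in> D"
    and contr: "\<And>m k. m + m + k \<in> D \<Longrightarrow> m + k \<in> D"
    and atoms: "\<forall>p\<in>set_fm A. decides I v m (Atom p)"
  shows "decides I v m A"
  using atoms
proof (induction A)
  case (Atom p)
  then show ?case by auto
next
  have D: "m \<in> perp D" using weak by (auto simp: perp_def add.commute)
  {
    case One
    then show ?case using D by (simp add: decides_def)
  next
    case Zero
    then show ?case using D by (simp add: decides_def)
  }
next
  case Top
  then show ?case by (simp add: decides_def)
next
  case Bot
  then show ?case by (simp add: decides_def)
next
  \<comment> \<open>Two positive factors put m + m into the sum, and contraction turns m + m back
    into m.\<close>
  have tens: "m \<in> perp (perp (X + Y))" if "m \<in> X" "m \<in> Y" for X Y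
  proof (rule perpI)
    fix k assume "k \<in> perp (X + Y)"
    then have "k + (m + m) \<in> D" using that by (blast intro: perpD)
    then show "m + k \<in> D" using contr[of m k] by (simp add: add.commute)
  qed
  \<comment> \<open>One refuted factor is enough: weakening absorbs the element taken from the other
    one.\<close>
  have par: "m \<in> perp (X + Y)" if "m \<in> perp X \<or> m \<in> perp Y" for X Y
  proof (rule perpI)
    fix k assume "k \<in> X + Y"
    then obtain x y where k: "k = x + y" and "x \<in> X" "y \<in> Y" by (auto elim: set_plus_elim)
    with that have "m + x \<in> D \<or> m + y \<in> D" by (auto simp: perp_def)
    then have "(m + x) + y \<in> D \<or> (m + y) + x \<in> D"
      using weak[of "m + x" y] weak[of "m + y" x] by argo
    moreover have "m + k = (m + x) + y" "m + k = (m + y) + x" by (simp_all add: k ac_simps)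
    ultimately show "m + k \<in> D" by metis
  qed
  have meet: "m \<in> perp (X \<inter> Y)" if "m \<in> perp X \<or> m \<in> perp Y" for X Y
    using that by (auto simp: perp_def)
  {
    case (And A B)
    then have "decides I v m A" "decides I v m B" by auto
    then show ?case using meet[of "itp I A" "itp I B"] by (auto simp: decides_def split: if_splits)
  next
    case (Or A B)
    then have "decides I v m A" "decides I v m B" by auto
    then show ?case using meet[of "perp (itp I A)" "perp (itp I B)"]
      by (auto simp: decides_def perp_perp_Int split: if_splits)
  next
    case (Fus A B)
    then have "decides I v m A" "decides I v m B" by auto
    then show ?case using tens[of "itp I A" "itp I B"] par[of "itp I A" "itp I B"]
      by (auto simp: decides_def split: if_splits)
  next
    case (Imp A B)
    then have "decides I v m A" "decides I v m B" by auto
    then show ?case using tens[of "itp I A" "perp (itp I B)"] par[of "itp I A" "perp (itp I B)"]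
      by (auto simp: decides_def split: if_splits)
  next
    case (Par A B)
    then have "decides I v m A" "decides I v m B" by auto
    then show ?case using tens[of "perp (itp I A)" "perp (itp I B)"]
        par[of "perp (itp I A)" "perp (itp I B)"]
      by (auto simp: decides_def split: if_splits)
  }
qed

text \<open>Case distinction on an atom p without an element that decides p: if every x in the value
  of p and every x in its \<open>perp\<close> gives m + x + t in the pole, then m + t lies in both
  the \<open>perp\<close> and the double \<open>perp\<close> of that value. So twice m + t is in the
  pole, and contraction removes one copy.\<close>

lemma mem_if_decided:
  assumes weak: "\<And>m k. m \<in> D \<Longrightarrow> m + k \<in> D"
    and contr: "\<And>m k. m + m + k \<in> D \<Longrightarrow> m + k \<in> D"
    and "finite T"
    and all: "\<And>v m. \<forall>p\<in>T. decides I v m (Atom p) \<Longrightarrow> m + t \<in> D"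
  shows "t \<in> D"
proof -
  have up: "m + x \<in> perp X" if "m \<in> perp X" for m x X
  proof (rule perpI)
    fix k assume "k \<in> X"
    then show "m + x + k \<in> D"
      using weak[OF perpD[OF that], of k x] by (simp add: ac_simps)
  qed
  have dec_up: "decides I v (m + x) (Atom p)" if "decides I v m (Atom p)" for v m x p
    using that up by (auto simp: decides_def)
  \<comment> \<open>S collects the atoms already eliminated. For S = T no condition on m remains,
    and m = 0 gives the claim.\<close>
  have "\<forall>m v. (\<forall>p\<in>T - S. decides I v m (Atom p)) \<longrightarrow> m + t \<in> D" if "finite S" for S
    using that
  proof induction
    case empty
    then show ?case using all by simp
  next
    case (insert p S)
    show ?case
    proof (intro allI impI)
      fix m v assume dec: "\<forall>q\<in>T - insert p S. decides I v m (Atom q)"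
      \<comment> \<open>The summand x settles p under the updated valuation, while m + x keeps the
        decisions of m on the other atoms.\<close>
      have "decides I (v(p := b)) (m + x) (Atom q)"
        if "if b then x \<in> itp I (Atom p) else x \<in> perp (itp I (Atom p))" "q \<in> T - S" for b x q
      proof (cases "q = p")
        case True
        then have "decides I (v(p := b)) x (Atom q)" using that by (simp add: decides_def)
        then show ?thesis using dec_up[of _ x q m] by (simp add: add.commute)
      next
        case False
        then have "decides I v m (Atom q)" using that dec by simp
        then have "decides I (v(p := b)) m (Atom q)" using False by (simp add: decides_def)
        then show ?thesis by (rule dec_up)
      qed
      then have *: "m + x + t \<in> D"
        if "if b then x \<in> itp I (Atom p) else x \<in> perp (itp I (Atom p))" for b x
        using that insert.IH by blast
      have "m + t \<in> perp (itp I (Atom p))"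
        using *[of True] by (intro perpI) (simp add: ac_simps)
      moreover have "m + t \<in> perp (perp (itp I (Atom p)))"
        using *[of False] by (intro perpI) (simp add: ac_simps)
      \<comment> \<open>The summand 0 only serves to fit the form of \<open>contr\<close>.\<close>
      ultimately have "(m + t) + (m + t) + 0 \<in> D"
        using perpD by fastforce
      then show "m + t \<in> D" using contr[of "m + t" 0] by simp
    qed
  qed
  from this[OF \<open>finite T\<close>] show ?thesis by (metis DiffD1 DiffD2 add_0)
qed

text \<open>Here and in the following lemmas, the last hypothesis is a rule with contexts m and k,
  active parts a and b, and principal part c. The shapes are: one premise, two premises sharing a
  context, two premises with separate contexts, and one premise with two active parts. Each turns
  membership of the active parts into membership of the principal part.\<close>

lemma perp_mono_mem:
  assumes "a \<in> perp X" "\<And>m. m + a \<in> D \<Longrightarrow> m + c \<in> D"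
  shows "c \<in> perp X"
  using assms by (auto simp: perp_def add.commute)

lemma itp_mono_mem:
  assumes "a \<in> itp I A" "\<And>m. m + a \<in> D \<Longrightarrow> m + c \<in> D"
  shows "c \<in> itp I A"
  using perp_mono_mem[of a "perp (itp I A)" c] assms by simp

lemma perp_Int_mem:
  assumes "a \<in> perp X" "b \<in> perp Y" "\<And>m. m + a \<in> D \<Longrightarrow> m + b \<in> D \<Longrightarrow> m + c \<in> D"
  shows "c \<in> perp (X \<inter> Y)"
  using assms by (auto simp: perp_def add.commute)

lemma perp_plus_mem:
  assumes "a \<in> perp X" "b \<in> perp Y"
    and "\<And>m k. m + a \<in> D \<Longrightarrow> k + b \<in> D \<Longrightarrow> m + k + c \<in> D"
  shows "c \<in> perp (X + Y)"
  using assms by (auto simp: perp_def add.commute elim!: set_plus_elim)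

lemma perp_perp_plus_mem:
  assumes "a \<in> X" "b \<in> Y" "\<And>m. m + (a + b) \<in> D \<Longrightarrow> m + c \<in> D"
  shows "c \<in> perp (perp (X + Y))"
proof (rule perp_mono_mem)
  show "a + b \<in> perp (perp (X + Y))" using assms(1,2) subset_perp_perp by blast
qed (rule assms(3))

end

section \<open>The calculus\<close>

abbreviation neg :: "'a fm \<Rightarrow> 'a fm" where
  "neg A \<equiv> Imp A Zero"

text \<open>In all these shapes, even meta-multiset variables are left contexts and odd ones are
  right contexts. \<open>left_rule\<close> and \<open>right_rule\<close> are a single block with one
  premise for each entry of the list; the split rules are two blocks with one premise each.\<close>

definition left_axiom :: "'a mform \<Rightarrow> 'a rule" where
  "left_axiom \<phi> = ([], ({#MVar 0, MForm \<phi>#}, {#MVar 1#}))"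

definition right_axiom :: "'a mform \<Rightarrow> 'a rule" where
  "right_axiom \<phi> = ([], ({#MVar 0#}, {#MVar 1, MForm \<phi>#}))"

definition left_rule :: "'a mform \<Rightarrow> 'a mform multiset list \<Rightarrow> 'a rule" where
  "left_rule \<phi> \<Phi>s =
    (map (\<lambda>\<Phi>. (add_mset (MVar 0) (image_mset MForm \<Phi>), {#MVar 1#})) \<Phi>s,
     ({#MForm \<phi>, MVar 0#}, {#MVar 1#}))"

definition right_rule :: "'a mform \<Rightarrow> 'a mform multiset list \<Rightarrow> 'a rule" where
  "right_rule \<phi> \<Phi>s =
    (map (\<lambda>\<Phi>. ({#MVar 0#}, add_mset (MVar 1) (image_mset MForm \<Phi>))) \<Phi>s,
     ({#MVar 0#}, {#MForm \<phi>, MVar 1#}))"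

definition left_split_rule :: "'a mform \<Rightarrow> 'a mform \<Rightarrow> 'a mform \<Rightarrow> 'a rule" where
  "left_split_rule \<phi> \<psi> \<chi> =
    ([({#MVar 0, MForm \<psi>#}, {#MVar 1#}), ({#MVar 2, MForm \<chi>#}, {#MVar 3#})],
     ({#MForm \<phi>, MVar 0, MVar 2#}, {#MVar 1, MVar 3#}))"

definition right_split_rule :: "'a mform \<Rightarrow> 'a mform \<Rightarrow> 'a mform \<Rightarrow> 'a rule" where
  "right_split_rule \<phi> \<psi> \<chi> =
    ([({#MVar 0#}, {#MVar 1, MForm \<psi>#}), ({#MVar 2#}, {#MVar 3, MForm \<chi>#})],
     ({#MVar 0, MVar 2#}, {#MForm \<phi>, MVar 1, MVar 3#}))"

lemmas rule_shape_defs = left_axiom_def right_axiom_def left_rule_def right_rule_def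
  left_split_rule_def right_split_rule_def

lemma focused_left_axiom: "focused_axiom (left_axiom \<phi>)"
  using focused_axiom.intros(4)[of "{#\<phi>#}" 0 1] by (simp add: left_axiom_def same_vars_def)

lemma focused_right_axiom: "focused_axiom (right_axiom \<phi>)"
  using focused_axiom.intros(5)[of "{#\<phi>#}" 0 1] by (simp add: right_axiom_def same_vars_def)

lemma focused_left_rule:
  "\<Phi>s \<noteq> [] \<Longrightarrow> (\<forall>\<Phi>\<in>set \<Phi>s. \<forall>\<psi>\<in>#\<Phi>. set_fm \<psi> \<subseteq> set_fm \<phi>) \<Longrightarrow> focused_rule (left_rule \<phi> \<Phi>s)"
  using focused_rule.left[of "[(0, 1, \<Phi>s)]" \<phi>]
  by (simp add: left_rule_def ok_blocks_def ctxL_def ctxR_def)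

lemma focused_right_rule:
  "\<Phi>s \<noteq> [] \<Longrightarrow> (\<forall>\<Phi>\<in>set \<Phi>s. \<forall>\<psi>\<in>#\<Phi>. set_fm \<psi> \<subseteq> set_fm \<phi>) \<Longrightarrow> focused_rule (right_rule \<phi> \<Phi>s)"
  using focused_rule.right[of "[(0, 1, \<Phi>s)]" \<phi>]
  by (simp add: right_rule_def ok_blocks_def ctxL_def ctxR_def)

lemma focused_left_split_rule:
  "set_fm \<psi> \<subseteq> set_fm \<phi> \<Longrightarrow> set_fm \<chi> \<subseteq> set_fm \<phi> \<Longrightarrow> focused_rule (left_split_rule \<phi> \<psi> \<chi>)"
  using focused_rule.left[of "[(0, 1, [{#\<psi>#}]), (2, 3, [{#\<chi>#}])]" \<phi>]
  by (simp add: left_split_rule_def ok_blocks_def ctxL_def ctxR_def)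

lemma focused_right_split_rule:
  "set_fm \<psi> \<subseteq> set_fm \<phi> \<Longrightarrow> set_fm \<chi> \<subseteq> set_fm \<phi> \<Longrightarrow> focused_rule (right_split_rule \<phi> \<psi> \<chi>)"
  using focused_rule.right[of "[(0, 1, [{#\<psi>#}]), (2, 3, [{#\<chi>#}])]" \<phi>]
  by (simp add: right_split_rule_def ok_blocks_def ctxL_def ctxR_def)

section \<open>The rules of the three calculi\<close>

abbreviation va :: "'a mform" where "va \<equiv> Atom (FVar 0)"
abbreviation vb :: "'a mform" where "vb \<equiv> Atom (FVar 1)"

text \<open>Focusing restricts only the variables of the active formulas, so \<open>neg va\<close>
  may be active although it is no subformula of the principal one. Negated compounds follow De
  Morgan duality. The identity axiom comes in three forms, since no rule carries a formula across
  the arrow to link \<open>va\<close> with \<open>neg va\<close>.\<close>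

definition logical_rules :: "'a rule set" where
  "logical_rules = {
    ([], ({#MForm va#}, {#MForm va#})),
    ([], ({#MForm va, MForm (neg va)#}, {#})),
    ([], ({#}, {#MForm va, MForm (neg va)#})),
    ([], ({#}, {#MForm One#})),
    ([], ({#MForm (neg One)#}, {#})),
    ([], ({#MForm Zero#}, {#})),
    ([], ({#}, {#MForm (neg Zero)#})),
    right_axiom Top, left_axiom (neg Top),
    left_axiom Bot, right_axiom (neg Bot),
    left_rule One [{#}], right_rule (neg One) [{#}],
    right_rule Zero [{#}], left_rule (neg Zero) [{#}],
    left_rule (And va vb) [{#va#}], left_rule (And va vb) [{#vb#}],
    right_rule (And va vb) [{#va#}, {#vb#}],
    right_rule (neg (And va vb)) [{#neg va#}], right_rule (neg (And va vb)) [{#neg vb#}],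
    left_rule (neg (And va vb)) [{#neg va#}, {#neg vb#}],
    right_rule (Or va vb) [{#va#}], right_rule (Or va vb) [{#vb#}],
    left_rule (Or va vb) [{#va#}, {#vb#}],
    left_rule (neg (Or va vb)) [{#neg va#}], left_rule (neg (Or va vb)) [{#neg vb#}],
    right_rule (neg (Or va vb)) [{#neg va#}, {#neg vb#}],
    left_rule (Fus va vb) [{#va, vb#}], right_split_rule (Fus va vb) va vb,
    right_rule (neg (Fus va vb)) [{#neg va, neg vb#}],
    left_split_rule (neg (Fus va vb)) (neg va) (neg vb),
    right_rule (Par va vb) [{#va, vb#}], left_split_rule (Par va vb) va vb,
    left_rule (neg (Par va vb)) [{#neg va, neg vb#}],
    right_split_rule (neg (Par va vb)) (neg va) (neg vb),
    right_rule (Imp va vb) [{#neg va, vb#}], left_split_rule (Imp va vb) (neg va) vb,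
    left_rule (neg (Imp va vb)) [{#va, neg vb#}],
    right_split_rule (neg (Imp va vb)) va (neg vb)}"

text \<open>An empty active multiset leaves the bare context as premise, so weakening is a focused
  rule whose principal formula is a variable.\<close>

definition weakening_rules :: "'a rule set" where
  "weakening_rules = {left_rule va [{#}], right_rule va [{#}]}"

definition contraction_rules :: "'a rule set" where
  "contraction_rules = {left_rule va [{#va, va#}], right_rule va [{#va, va#}]}"

lemma finite_rules:
  "finite logical_rules" "finite weakening_rules" "finite contraction_rules"
  by (simp_all add: logical_rules_def weakening_rules_def contraction_rules_def)

lemma focused_rules:
  "r \<in> logical_rules \<union> weakening_rules \<union> contraction_rules \<Longrightarrow> focused_rule r \<or> focused_axiom r"
proof -
  have 1: "focused_axiom ([], ({#MForm \<phi>#}, {#}))" "focused_axiom ([], ({#}, {#MForm \<phi>#}))"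
    for \<phi> :: "'a mform"
    using focused_axiom.intros(2,3)[of "{#\<phi>#}"] by (simp_all add: same_vars_def)
  have 2: "focused_axiom ([], ({#MForm \<phi>, MForm (neg \<phi>)#}, {#}))"
    "focused_axiom ([], ({#}, {#MForm \<phi>, MForm (neg \<phi>)#}))"
    for \<phi> :: "'a mform"
    using focused_axiom.intros(2,3)[of "{#\<phi>, neg \<phi>#}"] by (auto simp: same_vars_def)
  have "\<forall>r \<in> logical_rules \<union> weakening_rules \<union> contraction_rules.
      focused_rule (r :: 'a rule) \<or> focused_axiom r"
    unfolding logical_rules_def weakening_rules_def contraction_rules_def
    by (simp add: 1 2 focused_axiom.intros(1) focused_left_axiom focused_right_axiom
        focused_left_rule focused_right_rule focused_left_split_rule focused_right_split_rule)
  then show "r \<in> logical_rules \<union> weakening_rules \<union> contraction_rules \<Longrightarrow>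
      focused_rule r \<or> focused_axiom r" by blast
qed

subsection \<open>Soundness\<close>

definition preserves :: "('a sequent \<Rightarrow> bool) \<Rightarrow> 'a rule \<Rightarrow> bool" where
  "preserves S r \<longleftrightarrow> (\<forall>\<sigma> \<tau>. (\<forall>P\<in>set (fst r). S (inst_seq \<sigma> \<tau> P)) \<longrightarrow> S (inst_seq \<sigma> \<tau> (snd r)))"

lemma derivable_sound:
  assumes "derivable G s" "\<forall>r\<in>G. preserves S r"
  shows "S s"
  using assms(1)
  by (induction rule: derivable.induct) (use assms(2) in \<open>fastforce simp: preserves_def\<close>)

text \<open>Cut makes negation move formulas across the arrow in both directions. As simp rules,
  this lemma and \<open>CFL_neg_right\<close> reduce the rules for negated formulas to those of
  \<open>CFL\<close>.\<close>

lemma CFL_neg_left [simp]: "CFL w (add_mset (neg A) \<Gamma>) \<Delta> \<longleftrightarrow> CFL w \<Gamma> (add_mset A \<Delta>)"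
proof
  have "CFL w {#} {#neg A, A#}"
    using CFL.impR[OF CFL.zeroR[OF CFL.identity]] by blast
  then show "CFL w (add_mset (neg A) \<Gamma>) \<Delta> \<Longrightarrow> CFL w \<Gamma> (add_mset A \<Delta>)"
    using CFL.cut[of w "{#}" "neg A" "{#A#}" \<Gamma> \<Delta>] by simp
  show "CFL w \<Gamma> (add_mset A \<Delta>) \<Longrightarrow> CFL w (add_mset (neg A) \<Gamma>) \<Delta>"
    using CFL.impL[of w \<Gamma> A \<Delta> Zero "{#}" "{#}"] by (simp add: CFL.zeroL)
qed

lemma CFL_neg_right [simp]: "CFL w \<Gamma> (add_mset (neg A) \<Delta>) \<longleftrightarrow> CFL w (add_mset A \<Gamma>) \<Delta>"
proof
  have "CFL w {#neg A, A#} {#}"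
    using CFL.identity by simp
  then show "CFL w \<Gamma> (add_mset (neg A) \<Delta>) \<Longrightarrow> CFL w (add_mset A \<Gamma>) \<Delta>"
    using CFL.cut[of w \<Gamma> "neg A" \<Delta> "{#A#}" "{#}"] by simp
  show "CFL w (add_mset A \<Gamma>) \<Delta> \<Longrightarrow> CFL w \<Gamma> (add_mset (neg A) \<Delta>)"
    by (intro CFL.impR CFL.zeroR)
qed

lemma CFL_preserves_logical: "r \<in> logical_rules \<Longrightarrow> preserves (\<lambda>(\<Gamma>, \<Delta>). CFL w \<Gamma> \<Delta>) r"
proof -
  have [simp]: "CFL w {#A, neg A#} {#}" "CFL w {#} {#A, neg A#}" for A :: "'a fm"
    using CFL.identity[of w A] CFL_neg_left[of w A "{#A#}" "{#}"] CFL_neg_right[of w "{#}" A "{#A#}"]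
    by (simp_all add: add_mset_commute)
  \<comment> \<open>Variants with the active formulas in the opposite order, as they may arise from
    instantiating the rules. The third is \<open>impR\<close> with \<open>neg A\<close> still on the
    right.\<close>
  have commuted:
    "CFL w (add_mset B (add_mset A \<Gamma>)) \<Delta> \<Longrightarrow> CFL w (add_mset (Fus A B) \<Gamma>) \<Delta>"
    "CFL w \<Gamma> (add_mset B (add_mset A \<Delta>)) \<Longrightarrow> CFL w \<Gamma> (add_mset (Par A B) \<Delta>)"
    "CFL w \<Gamma> (add_mset B (add_mset (neg A) \<Delta>)) \<Longrightarrow> CFL w \<Gamma> (add_mset (Imp A B) \<Delta>)"
    for A B :: "'a fm" and \<Gamma> \<Delta>
    by (auto intro: CFL.intros simp: add_mset_commute[of B])
  have "\<forall>r\<in>logical_rules. preserves (\<lambda>(\<Gamma>, \<Delta>). CFL w \<Gamma> \<Delta>) (r :: 'a rule)"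
    unfolding logical_rules_def ball_simps
    by (intro conjI TrueI;
        simp add: preserves_def inst_seq_def inst_mset_def rule_shape_defs;
        auto intro: CFL.intros commuted)
  then show "r \<in> logical_rules \<Longrightarrow> preserves (\<lambda>(\<Gamma>, \<Delta>). CFL w \<Gamma> \<Delta>) r" by blast
qed


lemma CFL_preserves_weakening:
  "r \<in> weakening_rules \<Longrightarrow> preserves (\<lambda>(\<Gamma>, \<Delta>). CFL True \<Gamma> \<Delta>) r"
  by (auto simp: weakening_rules_def preserves_def inst_seq_def inst_mset_def rule_shape_defs
      intro: CFL.weakL CFL.weakR)

definition entails :: "'a sequent \<Rightarrow> bool" where
  "entails = (\<lambda>(\<Gamma>, \<Delta>). \<forall>v. (\<forall>A\<in>#\<Gamma>. truth v A) \<longrightarrow> (\<exists>B\<in>#\<Delta>. truth v B))"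

lemma entails_preserves:
  "r \<in> logical_rules \<union> weakening_rules \<union> contraction_rules \<Longrightarrow> preserves entails r"
proof -
  have "\<forall>r\<in>logical_rules \<union> weakening_rules \<union> contraction_rules. preserves entails (r :: 'a rule)"
    unfolding logical_rules_def weakening_rules_def contraction_rules_def ball_Un ball_simps
    by (intro conjI TrueI;
        simp add: preserves_def inst_seq_def inst_mset_def rule_shape_defs entails_def; blast)
  then show "r \<in> logical_rules \<union> weakening_rules \<union> contraction_rules \<Longrightarrow> preserves entails r"
    by blast
qed

subsection \<open>Completeness\<close>

text \<open>Sequents form a commutative monoid under componentwise union, so
  \<open>m + on_left A\<close> is m with A added to its antecedent, and m plays the role of a
  context.\<close>

abbreviation on_left :: "'a fm \<Rightarrow> 'a sequent" where
  "on_left A \<equiv> ({#A#}, {#})"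

abbreviation on_right :: "'a fm \<Rightarrow> 'a sequent" where
  "on_right A \<equiv> ({#}, {#A#})"

lemma derivable_rule:
  assumes "r \<in> G" "\<forall>P\<in>set (fst r). derivable G (inst_seq \<sigma> \<tau> P)"
  shows "derivable G (inst_seq \<sigma> \<tau> (snd r))"
  using assms derivable.intros[of "fst r" "snd r"] by simp

lemma derivable_left_rule:
  assumes "left_rule \<phi> \<Phi>s \<in> G"
    and "\<forall>\<Phi>\<in>set \<Phi>s. derivable G (m + (image_mset (inst \<sigma>) \<Phi>, {#}))"
  shows "derivable G (m + on_left (inst \<sigma> \<phi>))"
  \<comment> \<open>\<open>MVar 0\<close> receives the antecedent of m; every other index, in
    particular \<open>MVar 1\<close>, receives its succedent.\<close>
  using assms(2) derivable_rule[OF assms(1), of \<sigma> "\<lambda>n. if n = 0 then fst m else snd m"]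
  by (cases m) (simp add: left_rule_def inst_seq_def inst_mset_def
      image_mset.compositionality comp_def add.commute)

lemma derivable_right_rule:
  assumes "right_rule \<phi> \<Phi>s \<in> G"
    and "\<forall>\<Phi>\<in>set \<Phi>s. derivable G (m + ({#}, image_mset (inst \<sigma>) \<Phi>))"
  shows "derivable G (m + on_right (inst \<sigma> \<phi>))"
  using assms(2) derivable_rule[OF assms(1), of \<sigma> "\<lambda>n. if n = 0 then fst m else snd m"]
  by (cases m) (simp add: right_rule_def inst_seq_def inst_mset_def
      image_mset.compositionality comp_def add.commute)

lemma derivable_left_split_rule:
  assumes "left_split_rule \<phi> \<psi> \<chi> \<in> G"
    and "derivable G (m + on_left (inst \<sigma> \<psi>))" "derivable G (k + on_left (inst \<sigma> \<chi>))"
  shows "derivable G (m + k + on_left (inst \<sigma> \<phi>))"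
  using assms(2,3) derivable_rule[OF assms(1), of \<sigma>
      "\<lambda>n. if n = 0 then fst m else if n = 1 then snd m else if n = 2 then fst k else snd k"]
  by (cases m; cases k) (simp add: left_split_rule_def inst_seq_def inst_mset_def add.commute)

lemma derivable_right_split_rule:
  assumes "right_split_rule \<phi> \<psi> \<chi> \<in> G"
    and "derivable G (m + on_right (inst \<sigma> \<psi>))" "derivable G (k + on_right (inst \<sigma> \<chi>))"
  shows "derivable G (m + k + on_right (inst \<sigma> \<phi>))"
  using assms(2,3) derivable_rule[OF assms(1), of \<sigma>
      "\<lambda>n. if n = 0 then fst m else if n = 1 then snd m else if n = 2 then fst k else snd k"]
  by (cases m; cases k) (simp add: right_split_rule_def inst_seq_def inst_mset_def add.commute)

lemma derivable_left_axiom: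
  assumes "left_axiom \<phi> \<in> G"
  shows "derivable G (m + on_left (inst \<sigma> \<phi>))"
  using derivable_rule[OF assms, of \<sigma> "\<lambda>n. if n = 0 then fst m else snd m"]
  by (cases m) (simp add: left_axiom_def inst_seq_def inst_mset_def)

lemma derivable_right_axiom:
  assumes "right_axiom \<phi> \<in> G"
  shows "derivable G (m + on_right (inst \<sigma> \<phi>))"
  using derivable_rule[OF assms, of \<sigma> "\<lambda>n. if n = 0 then fst m else snd m"]
  by (cases m) (simp add: right_axiom_def inst_seq_def inst_mset_def)


section \<open>Okada's lemma and completeness without cut\<close>

context
  fixes G :: "'a rule set"
  assumes logical: "logical_rules \<subseteq> G"
begin

interpretation phase_space "{s. derivable G s}" .

text \<open>The least set that the atomic case of \<open>formula_mem_itp\<close> allows. Its two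
  members pair with \<open>on_right (Atom p)\<close> and \<open>on_left (neg (Atom p))\<close> to
  four sequents, all instances of the identity axioms.\<close>

private definition I :: "'a \<Rightarrow> 'a sequent set" where
  "I p = {on_left (Atom p), on_right (neg (Atom p))}"

private abbreviation pair :: "'a fm \<Rightarrow> 'a fm \<Rightarrow> nat \<Rightarrow> 'a fm" where
  "pair A B \<equiv> \<lambda>n. if n = 0 then A else B"

lemma derivable_axioms:
  "derivable G (on_left A + on_right A)"
  "derivable G (on_left A + on_left (neg A))"
  "derivable G (on_right A + on_right (neg A))"
  "derivable G (on_right One)" "derivable G (on_left (neg One))"
  "derivable G (on_left Zero)" "derivable G (on_right (neg Zero))"
proof -
  have *: "derivable G (inst_seq (\<lambda>_. A) (\<lambda>_. {#}) C)" if "([], C) \<in> logical_rules" for C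
    using derivable_rule[of "([], C)" G] that logical by auto
  note simps = logical_rules_def inst_seq_def inst_mset_def
  show "derivable G (on_left A + on_right A)"
    using *[of "({#MForm va#}, {#MForm va#})"] by (simp add: simps)
  show "derivable G (on_left A + on_left (neg A))"
    using *[of "({#MForm va, MForm (neg va)#}, {#})"] by (simp add: simps add_mset_commute)
  show "derivable G (on_right A + on_right (neg A))"
    using *[of "({#}, {#MForm va, MForm (neg va)#})"] by (simp add: simps add_mset_commute)
  show "derivable G (on_right One)"
    using *[of "({#}, {#MForm One#})"] by (simp add: simps)
  show "derivable G (on_left (neg One))"
    using *[of "({#MForm (neg One)#}, {#})"] by (simp add: simps)
  show "derivable G (on_left Zero)"
    using *[of "({#MForm Zero#}, {#})"] by (simp add: simps)
  show "derivable G (on_right (neg Zero))"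
    using *[of "({#}, {#MForm (neg Zero)#})"] by (simp add: simps)
qed

lemma derivable_lattice_axioms:
  "derivable G (m + on_right Top)" "derivable G (m + on_left (neg Top))"
  "derivable G (m + on_left Bot)" "derivable G (m + on_right (neg Bot))"
proof -
  note L = derivable_left_axiom[OF subsetD[OF logical]]
    and R = derivable_right_axiom[OF subsetD[OF logical]]
  show "derivable G (m + on_right Top)" using R[of Top] by (simp add: logical_rules_def)
  show "derivable G (m + on_left (neg Top))" using L[of "neg Top"] by (simp add: logical_rules_def)
  show "derivable G (m + on_left Bot)" using L[of Bot] by (simp add: logical_rules_def)
  show "derivable G (m + on_right (neg Bot))" using R[of "neg Bot"] by (simp add: logical_rules_def)
qed

private lemmas L = derivable_left_rule[OF subsetD[OF logical]]
private lemmas R = derivable_right_rule[OF subsetD[OF logical]]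
private lemmas L2 = derivable_left_split_rule[OF subsetD[OF logical]]
private lemmas R2 = derivable_right_split_rule[OF subsetD[OF logical]]

lemma derivable_unit_rules:
  assumes "derivable G m"
  shows "derivable G (m + on_left One)" "derivable G (m + on_right (neg One))"
    "derivable G (m + on_right Zero)" "derivable G (m + on_left (neg Zero))"
  using assms L[of One "[{#}]" m] R[of "neg One" "[{#}]" m]
    R[of Zero "[{#}]" m] L[of "neg Zero" "[{#}]" m]
  by (simp_all add: logical_rules_def flip: zero_prod_def)

lemma derivable_And_rules:
  "derivable G (m + on_left A) \<Longrightarrow> derivable G (m + on_left (And A B))"
  "derivable G (m + on_left B) \<Longrightarrow> derivable G (m + on_left (And A B))"
  "derivable G (m + on_right (neg A)) \<Longrightarrow> derivable G (m + on_right (neg (And A B)))"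
  "derivable G (m + on_right (neg B)) \<Longrightarrow> derivable G (m + on_right (neg (And A B)))"
  "derivable G (m + on_right A) \<Longrightarrow> derivable G (m + on_right B) \<Longrightarrow>
     derivable G (m + on_right (And A B))"
  "derivable G (m + on_left (neg A)) \<Longrightarrow> derivable G (m + on_left (neg B)) \<Longrightarrow>
     derivable G (m + on_left (neg (And A B)))"
  using L[of "And va vb" "[{#va#}]" m "pair A B"] L[of "And va vb" "[{#vb#}]" m "pair A B"]
    R[of "neg (And va vb)" "[{#neg va#}]" m "pair A B"]
    R[of "neg (And va vb)" "[{#neg vb#}]" m "pair A B"]
    R[of "And va vb" "[{#va#}, {#vb#}]" m "pair A B"]
    L[of "neg (And va vb)" "[{#neg va#}, {#neg vb#}]" m "pair A B"]
  by (simp_all add: logical_rules_def)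

lemma derivable_Or_rules:
  "derivable G (m + on_right A) \<Longrightarrow> derivable G (m + on_right (Or A B))"
  "derivable G (m + on_right B) \<Longrightarrow> derivable G (m + on_right (Or A B))"
  "derivable G (m + on_left (neg A)) \<Longrightarrow> derivable G (m + on_left (neg (Or A B)))"
  "derivable G (m + on_left (neg B)) \<Longrightarrow> derivable G (m + on_left (neg (Or A B)))"
  "derivable G (m + on_left A) \<Longrightarrow> derivable G (m + on_left B) \<Longrightarrow>
     derivable G (m + on_left (Or A B))"
  "derivable G (m + on_right (neg A)) \<Longrightarrow> derivable G (m + on_right (neg B)) \<Longrightarrow>
     derivable G (m + on_right (neg (Or A B)))"
  using R[of "Or va vb" "[{#va#}]" m "pair A B"] R[of "Or va vb" "[{#vb#}]" m "pair A B"]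
    L[of "neg (Or va vb)" "[{#neg va#}]" m "pair A B"]
    L[of "neg (Or va vb)" "[{#neg vb#}]" m "pair A B"]
    L[of "Or va vb" "[{#va#}, {#vb#}]" m "pair A B"]
    R[of "neg (Or va vb)" "[{#neg va#}, {#neg vb#}]" m "pair A B"]
  by (simp_all add: logical_rules_def)

text \<open>The active formulas are written as a sum of two sequents to match
  \<open>perp_perp_plus_mem\<close>.\<close>

lemma derivable_join_rules:
  "derivable G (m + (on_left A + on_left B)) \<Longrightarrow> derivable G (m + on_left (Fus A B))"
  "derivable G (m + (on_right (neg A) + on_right (neg B))) \<Longrightarrow>
     derivable G (m + on_right (neg (Fus A B)))"
  "derivable G (m + (on_right A + on_right B)) \<Longrightarrow> derivable G (m + on_right (Par A B))"
  "derivable G (m + (on_left (neg A) + on_left (neg B))) \<Longrightarrow>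
     derivable G (m + on_left (neg (Par A B)))"
  "derivable G (m + (on_right (neg A) + on_right B)) \<Longrightarrow> derivable G (m + on_right (Imp A B))"
  "derivable G (m + (on_left A + on_left (neg B))) \<Longrightarrow> derivable G (m + on_left (neg (Imp A B)))"
  using L[of "Fus va vb" "[{#va, vb#}]" m "pair A B"]
    R[of "neg (Fus va vb)" "[{#neg va, neg vb#}]" m "pair A B"]
    R[of "Par va vb" "[{#va, vb#}]" m "pair A B"]
    L[of "neg (Par va vb)" "[{#neg va, neg vb#}]" m "pair A B"]
    R[of "Imp va vb" "[{#neg va, vb#}]" m "pair A B"]
    L[of "neg (Imp va vb)" "[{#va, neg vb#}]" m "pair A B"]
  by (simp_all add: logical_rules_def add_mset_commute)

lemma derivable_split_rules:
  "derivable G (m + on_right A) \<Longrightarrow> derivable G (k + on_right B) \<Longrightarrow>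
     derivable G (m + k + on_right (Fus A B))"
  "derivable G (m + on_left (neg A)) \<Longrightarrow> derivable G (k + on_left (neg B)) \<Longrightarrow>
     derivable G (m + k + on_left (neg (Fus A B)))"
  "derivable G (m + on_left A) \<Longrightarrow> derivable G (k + on_left B) \<Longrightarrow>
     derivable G (m + k + on_left (Par A B))"
  "derivable G (m + on_right (neg A)) \<Longrightarrow> derivable G (k + on_right (neg B)) \<Longrightarrow>
     derivable G (m + k + on_right (neg (Par A B)))"
  "derivable G (m + on_left (neg A)) \<Longrightarrow> derivable G (k + on_left B) \<Longrightarrow>
     derivable G (m + k + on_left (Imp A B))"
  "derivable G (m + on_right A) \<Longrightarrow> derivable G (k + on_right (neg B)) \<Longrightarrow>
     derivable G (m + k + on_right (neg (Imp A B)))"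
  using R2[of "Fus va vb" va vb m "pair A B" k]
    L2[of "neg (Fus va vb)" "neg va" "neg vb" m "pair A B" k]
    L2[of "Par va vb" va vb m "pair A B" k]
    R2[of "neg (Par va vb)" "neg va" "neg vb" m "pair A B" k]
    L2[of "Imp va vb" "neg va" vb m "pair A B" k]
    R2[of "neg (Imp va vb)" va "neg vb" m "pair A B" k]
  by (simp_all add: logical_rules_def)

text \<open>The four memberships need each other: for \<open>Imp A B\<close>, the antecedent A is
  represented in \<open>itp I A\<close> by \<open>on_right (neg A)\<close> and in its
  \<open>perp\<close> by \<open>on_left (neg A)\<close>, so the induction never moves a formula
  across the arrow.\<close>

lemma formula_mem_itp:
  "on_left A \<in> itp I A \<and> on_right (neg A) \<in> itp I A \<and>
   on_right A \<in> perp (itp I A) \<and> on_left (neg A) \<in> perp (itp I A)"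
proof (induction A)
  case (Atom p)
  have "I p \<subseteq> itp I (Atom p)" using subset_perp_perp by simp
  moreover have "on_right (Atom p) \<in> perp (I p)" "on_left (neg (Atom p)) \<in> perp (I p)"
    using derivable_axioms(1-3)[of "Atom p"] derivable_axioms(1)[of "neg (Atom p)"]
    by (simp_all add: I_def perp_def add_mset_commute)
  ultimately show ?case by (simp add: I_def)
next
  case One
  \<comment> \<open>Without \<open>add_Pair\<close>, sums of sequents stay sums and match the
    derived rules.\<close>
  show ?case using derivable_axioms(4,5) derivable_unit_rules(1,2)
    by (auto simp: perp_def simp del: add_Pair simp: add.commute)
next
  case Zero
  show ?case using derivable_axioms(6,7) derivable_unit_rules(3,4)
    by (auto simp: perp_def simp del: add_Pair simp: add.commute)
next
  case Top
  show ?case using derivable_lattice_axioms(1,2)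
    by (auto simp: perp_def simp del: add_Pair simp: add.commute)
next
  case Bot
  show ?case using derivable_lattice_axioms(3,4)
    by (auto simp: perp_def simp del: add_Pair simp: add.commute)
next
  case (And A B)
  then show ?case
    using derivable_And_rules
    by (auto intro: itp_mono_mem perp_Int_mem)
next
  case (Or A B)
  then show ?case
    using derivable_Or_rules
    by (auto simp: perp_perp_Int intro: perp_mono_mem
        perp_Int_mem[of _ "perp (itp I A)" _ "perp (itp I B)"])
next
  case (Fus A B)
  then show ?case
    using derivable_join_rules(1,2) derivable_split_rules(1,2)
    by (auto simp del: add_Pair intro: perp_plus_mem perp_perp_plus_mem)
next
  case (Imp A B)
  then show ?case
    using derivable_join_rules(5,6) derivable_split_rules(5,6)
    by (auto simp del: add_Pair intro: perp_plus_mem[where Y = "perp _"] perp_perp_plus_mem)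
next
  case (Par A B)
  then show ?case
    using derivable_join_rules(3,4) derivable_split_rules(3,4)
    by (auto simp del: add_Pair
        intro: perp_plus_mem[where X = "perp _" and Y = "perp _"] perp_perp_plus_mem)
qed

lemma mem_sum_mset:
  assumes "\<And>A. f A \<in> F A"
  shows "(\<Sum>A\<in>#\<Gamma>. f A) \<in> (\<Sum>A\<in>#\<Gamma>. F A :: 'b::comm_monoid_add set)"
  by (induction \<Gamma>) (use assms in auto)

text \<open>Cut elimination: the sequent is the sum of its one-formula sequents, hence an element of
  the set that soundness places inside the pole.\<close>

lemma derivable_if_CFL:
  assumes "CFL w \<Gamma> \<Delta>" and "\<And>m k. w \<Longrightarrow> derivable G m \<Longrightarrow> derivable G (m + k)"
  shows "derivable G (\<Gamma>, \<Delta>)"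
proof -
  have "holds I \<Gamma> \<Delta>" using CFL_holds[OF assms(1)] assms(2) by simp
  moreover have "(\<Sum>A\<in>#\<Gamma>. on_left A) \<in> (\<Sum>A\<in>#\<Gamma>. itp I A)"
    "(\<Sum>B\<in>#\<Delta>. on_right B) \<in> (\<Sum>B\<in>#\<Delta>. perp (itp I B))"
    using formula_mem_itp by (auto intro: mem_sum_mset)
  ultimately have "derivable G ((\<Sum>A\<in>#\<Gamma>. on_left A) + (\<Sum>B\<in>#\<Delta>. on_right B))"
    unfolding holds_def by blast
  moreover have "(\<Sum>A\<in>#\<Gamma>. on_left A) = (\<Gamma>, {#})" by (induction \<Gamma>) (simp_all add: zero_prod_def)
  moreover have "(\<Sum>B\<in>#\<Delta>. on_right B) = ({#}, \<Delta>)" by (induction \<Delta>) (simp_all add: zero_prod_def)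
  ultimately show ?thesis by simp
qed

text \<open>If m decides all atoms, it refutes some A in the antecedent or verifies some B in the
  succedent. By \<open>formula_mem_itp\<close>, m together with that formula is derivable, and
  weakening adds the rest of the sequent. Then \<open>mem_if_decided\<close> discharges m.\<close>

lemma derivable_if_entails:
  assumes weak: "\<And>m k. derivable G m \<Longrightarrow> derivable G (m + k)"
    and contr: "\<And>m k. derivable G (m + m + k) \<Longrightarrow> derivable G (m + k)"
    and entails: "entails (\<Gamma>, \<Delta>)"
  shows "derivable G (\<Gamma>, \<Delta>)"
proof -
  let ?T = "\<Union>A\<in>set_mset (\<Gamma> + \<Delta>). set_fm A"
  have "finite (set_fm A)" for A :: "'a fm" by (induction A) auto
  then have "finite ?T" by simp
  moreover have "derivable G (m + (\<Gamma>, \<Delta>))" if m: "\<forall>p\<in>?T. decides I v m (Atom p)" for v m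
  proof -
    have dec: "decides I v m A" if "A \<in># \<Gamma> + \<Delta>" for A
      using decides_if_decides_atoms[of A I v m] weak contr m that by blast
    from entails consider A where "A \<in># \<Gamma>" "\<not> truth v A" | B where "B \<in># \<Delta>" "truth v B"
      unfolding entails_def by blast
    then show ?thesis
    proof cases
      case 1
      then have "m \<in> perp (itp I A)" using dec[of A] by (simp add: decides_def)
      then have "derivable G (m + on_left A)"
        using perpD[of m "itp I A" "on_left A"] formula_mem_itp by blast
      moreover obtain \<Gamma>' where "\<Gamma> = add_mset A \<Gamma>'" using 1 mset_add by metis
      ultimately show ?thesis using weak[of "m + on_left A" "(\<Gamma>', \<Delta>)"] by (simp add: add.assoc)
    next
      case 2
      then have "m \<in> itp I B" using dec[of B] by (simp add: decides_def)
      then have "derivable G (m + on_right B)"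
        using perpD[of "on_right B" "itp I B" m] formula_mem_itp by (auto simp: add.commute)
      moreover obtain \<Delta>' where "\<Delta> = add_mset B \<Delta>'" using 2 mset_add by metis
      ultimately show ?thesis using weak[of "m + on_right B" "(\<Gamma>, \<Delta>')"] by (simp add: add.assoc)
    qed
  qed
  ultimately show ?thesis
    using mem_if_decided[of ?T I "(\<Gamma>, \<Delta>)"] weak contr by blast
qed

end

section \<open>Weakening and contraction by whole sequents\<close>

lemma derivable_weaken:
  assumes "weakening_rules \<subseteq> G" "derivable G m"
  shows "derivable G (m + k)"
proof -
  have L: "derivable G (m + on_left A)" if "derivable G m" for m A
    using derivable_left_rule[of va "[{#}]" G m "\<lambda>_. A"] assms(1) that
    by (simp add: weakening_rules_def flip: zero_prod_def)
  have R: "derivable G (m + on_right A)" if "derivable G m" for m A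
    using derivable_right_rule[of va "[{#}]" G m "\<lambda>_. A"] assms(1) that
    by (simp add: weakening_rules_def flip: zero_prod_def)
  have "derivable G (m + (\<Gamma>, {#}))" for \<Gamma>
    by (induction \<Gamma>) (use assms(2) L in \<open>fastforce simp: add.assoc simp flip: zero_prod_def\<close>)+
  then have "derivable G (m + (\<Gamma>, {#}) + ({#}, \<Delta>))" for \<Gamma> \<Delta>
    by (induction \<Delta>) (use R in \<open>fastforce simp: add.assoc simp flip: zero_prod_def\<close>)+
  from this[of "fst k" "snd k"] show ?thesis by (simp add: add.assoc)
qed

lemma derivable_contract:
  assumes "contraction_rules \<subseteq> G" "derivable G (m + m + k)"
  shows "derivable G (m + k)"
proof -
  have L: "derivable G (on_left A + m)" if "derivable G (on_left A + (on_left A + m))" for m A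
    using derivable_left_rule[of va "[{#va, va#}]" G m "\<lambda>_. A"] assms(1) that
    by (cases m) (simp add: contraction_rules_def)
  have R: "derivable G (on_right A + m)" if "derivable G (on_right A + (on_right A + m))" for m A
    using derivable_right_rule[of va "[{#va, va#}]" G m "\<lambda>_. A"] assms(1) that
    by (cases m) (simp add: contraction_rules_def)
  have left: "derivable G ((\<Gamma>, {#}) + k)" if "derivable G ((\<Gamma>, {#}) + (\<Gamma>, {#}) + k)" for \<Gamma> k
    using that
  proof (induction \<Gamma> arbitrary: k)
    case empty
    then show ?case by simp
  next
    case (add A \<Gamma>)
    \<comment> \<open>Both copies of A wait in the context while the induction hypothesis contracts
      the rest; this is why k is arbitrary.\<close>
    have "derivable G ((\<Gamma>, {#}) + (on_left A + (on_left A + k)))"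
      by (rule add.IH) (use add.prems in \<open>cases k; simp add: ac_simps\<close>)
    then show ?case using L[of A "(\<Gamma>, {#}) + k"] by (cases k) simp
  qed
  have right: "derivable G (({#}, \<Delta>) + k)" if "derivable G (({#}, \<Delta>) + ({#}, \<Delta>) + k)" for \<Delta> k
    using that
  proof (induction \<Delta> arbitrary: k)
    case empty
    then show ?case by simp
  next
    case (add A \<Delta>)
    have "derivable G (({#}, \<Delta>) + (on_right A + (on_right A + k)))"
      by (rule add.IH) (use add.prems in \<open>cases k; simp add: ac_simps\<close>)
    then show ?case using R[of A "({#}, \<Delta>) + k"] by (cases k) simp
  qed
  obtain \<Gamma> \<Delta> where m: "m = (\<Gamma>, \<Delta>)" by (cases m)
  have "derivable G ((\<Gamma>, {#}) + (({#}, \<Delta> + \<Delta>) + k))"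
    by (rule left) (use assms(2) m in \<open>cases k; simp add: add.assoc\<close>)
  then have "derivable G (({#}, \<Delta>) + ((\<Gamma>, {#}) + k))"
    by (intro right) (cases k; simp add: add.assoc)
  then show ?thesis using m by (cases k) simp
qed

section \<open>Sequents as formulas\<close>

text \<open>The left rules for \<open>One\<close> and \<open>Fus\<close> are invertible: cut against
  the sequent that derives the unit or the fusion from its parts.\<close>

lemma CFL_big_fus: "CFL w (add_mset (big_fus xs) \<Sigma>) \<Delta> \<longleftrightarrow> CFL w (mset xs + \<Sigma>) \<Delta>"
proof (induction xs arbitrary: \<Sigma> rule: big_fus.induct)
  case 1
  show ?case using CFL.cut[OF CFL.oneR, of w \<Sigma> \<Delta>] CFL.oneL by auto
next
  case (2 x)
  show ?case by simp
next
  case (3 x y zs)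
  let ?B = "big_fus (y # zs)"
  have "CFL w {#x, ?B#} {#Fus x ?B#}"
    using CFL.fusR[OF CFL.identity[of w x] CFL.identity[of w ?B]]
    by (simp add: add_mset_commute)
  then have "CFL w (add_mset (Fus x ?B) \<Sigma>) \<Delta> \<longleftrightarrow> CFL w (add_mset ?B (add_mset x \<Sigma>)) \<Delta>"
    using CFL.cut[of w "{#x, ?B#}" "Fus x ?B" "{#}" \<Sigma> \<Delta>] CFL.fusL[of w x ?B \<Sigma> \<Delta>]
    by (auto simp: add_mset_commute)
  then show ?case using 3[of "add_mset x \<Sigma>"] by (simp add: add_mset_commute)
qed

lemma CFL_big_par: "CFL w \<Gamma> (add_mset (big_par xs) \<Sigma>) \<longleftrightarrow> CFL w \<Gamma> (mset xs + \<Sigma>)"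
proof (induction xs arbitrary: \<Sigma> rule: big_par.induct)
  case 1
  show ?case using CFL.cut[of w \<Gamma> Zero \<Sigma> "{#}" "{#}"] CFL.zeroL CFL.zeroR by auto
next
  case (2 x)
  show ?case by simp
next
  case (3 x y zs)
  let ?B = "big_par (y # zs)"
  have "CFL w {#Par x ?B#} {#x, ?B#}"
    using CFL.parL[OF CFL.identity[of w x] CFL.identity[of w ?B]]
    by (simp add: add_mset_commute)
  then have "CFL w \<Gamma> (add_mset (Par x ?B) \<Sigma>) \<longleftrightarrow> CFL w \<Gamma> (add_mset ?B (add_mset x \<Sigma>))"
    using CFL.cut[of w \<Gamma> "Par x ?B" \<Sigma> "{#}" "{#x, ?B#}"] CFL.parR[of w \<Gamma> x ?B \<Sigma>]
    by (auto simp: add_mset_commute)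
  then show ?case using 3[of "add_mset x \<Sigma>"] by (simp add: add_mset_commute)
qed

lemma CFL_Imp_iff: "CFL w {#} {#Imp A B#} \<longleftrightarrow> CFL w {#A#} {#B#}"
proof
  have "CFL w {#Imp A B, A#} {#B#}"
    using CFL.impL[OF CFL.identity[of w A, folded add_mset_add_single] CFL.identity[of w B]] by simp
  then show "CFL w {#} {#Imp A B#} \<Longrightarrow> CFL w {#A#} {#B#}"
    using CFL.cut[of w "{#}" "Imp A B" "{#}" "{#A#}" "{#B#}"] by simp
qed (rule CFL.impR)

lemma CFL_sequent_iff:
  "CFL w {#} {#Imp (big_fus \<Gamma>) (big_par \<Delta>)#} \<longleftrightarrow> CFL w (mset \<Gamma>) (mset \<Delta>)"
  using CFL_big_fus[of w \<Gamma> "{#}"] CFL_big_par[of w _ \<Delta> "{#}"] by (simp add: CFL_Imp_iff)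

lemma truth_big_fus: "truth v (big_fus xs) \<longleftrightarrow> (\<forall>A\<in>set xs. truth v A)"
  by (induction xs rule: big_fus.induct) auto

lemma truth_big_par: "truth v (big_par xs) \<longleftrightarrow> (\<exists>A\<in>set xs. truth v A)"
  by (induction xs rule: big_par.induct) auto

section \<open>Adequacy of the three calculi\<close>

lemma calculus_for_CFL_e: "calculus_for logical_rules CFL_e"
proof -
  have "derivable logical_rules (\<Gamma>, \<Delta>) \<longleftrightarrow> CFL False \<Gamma> \<Delta>" for \<Gamma> \<Delta> :: "'a fm multiset"
    using derivable_sound[of logical_rules "(\<Gamma>, \<Delta>)" "\<lambda>(\<Gamma>, \<Delta>). CFL False \<Gamma> \<Delta>"]
      derivable_if_CFL[of logical_rules False \<Gamma> \<Delta>] CFL_preserves_logical by blast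
  then show ?thesis by (simp add: calculus_for_def CFL_e_def CFL_sequent_iff)
qed

lemma calculus_for_CFL_ew: "calculus_for (logical_rules \<union> weakening_rules) CFL_ew"
proof -
  let ?G = "logical_rules \<union> weakening_rules"
  have "derivable ?G (\<Gamma>, \<Delta>) \<longleftrightarrow> CFL True \<Gamma> \<Delta>" for \<Gamma> \<Delta> :: "'a fm multiset"
    using derivable_sound[of ?G "(\<Gamma>, \<Delta>)" "\<lambda>(\<Gamma>, \<Delta>). CFL True \<Gamma> \<Delta>"]
      derivable_if_CFL[OF _ _ derivable_weaken, of ?G True \<Gamma> \<Delta>]
      CFL_preserves_logical CFL_preserves_weakening by blast
  then show ?thesis by (simp add: calculus_for_def CFL_ew_def CFL_sequent_iff)
qed

lemma calculus_for_CPC: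
  "calculus_for (logical_rules \<union> weakening_rules \<union> contraction_rules) CPC"
proof -
  let ?G = "logical_rules \<union> weakening_rules \<union> contraction_rules"
  have "derivable ?G (\<Gamma>, \<Delta>) \<longleftrightarrow> entails (\<Gamma>, \<Delta>)" for \<Gamma> \<Delta> :: "'a fm multiset"
    using derivable_sound[of ?G "(\<Gamma>, \<Delta>)" entails] entails_preserves
      derivable_if_entails[OF _ derivable_weaken derivable_contract, of ?G \<Gamma> \<Delta>] by blast
  then show ?thesis
    by (simp add: calculus_for_def CPC_def entails_def truth_big_fus truth_big_par)
qed

theorem theorem5p6:
  "\<forall>L \<in> {CFL_e, CFL_ew, CPC :: 'a fm set}.
     \<exists>G :: 'a rule set. finite G \<and> (\<forall>r \<in> G. focused_rule r \<or> focused_axiom r) \<and> calculus_for G L"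
proof
  fix L :: "'a fm set" assume "L \<in> {CFL_e, CFL_ew, CPC}"
  then consider "L = CFL_e" | "L = CFL_ew" | "L = CPC" by blast
  \<comment> \<open>All three calculi lie in one finite set of focused rules and axioms, so
    finiteness and focusing are inherited from it.\<close>
  then have "\<exists>G \<subseteq> logical_rules \<union> weakening_rules \<union> contraction_rules. calculus_for G L"
    using calculus_for_CFL_e calculus_for_CFL_ew calculus_for_CPC by cases blast+
  then obtain G where "G \<subseteq> logical_rules \<union> weakening_rules \<union> contraction_rules"
    and "calculus_for G L" by blast
  moreover from this(1) have "finite G"
    using finite_rules finite_subset by blast
  ultimately show "\<exists>G. finite G \<and> (\<forall>r\<in>G. focused_rule r \<or> focused_axiom r) \<and> calculus_for G L"
    using focused_rules by blast
qed

end
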